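(* Let $u_\alpha(t) \in H_\alpha$, $\alpha = 1,2,\ldots, p$, be the solution of the problem $$\frac{d u_\alpha }{d t} + \sum_{\beta = 1}^{p} G_\alpha A G_\beta^* \, u_\beta = G_\alpha f(t), \quad 0 < t \leq T , \qquad u_\alpha(0) = G_\alpha u^0, \quad \alpha=1,2,\ldots,p .$$ Then the function $$u(t) = \sum_{\alpha=1}^{p} G_\alpha^* u_\alpha(t)$$ is a solution of the Cauchy problem $$\frac{d u}{d t} + A u = f(t), \quad 0 < t \leq T, \qquad u(0)= u^0 .$$
   Context: $H$ and $H_\alpha$, $\alpha=1,2,\ldots,p$, are finite-dimensional Hilbert spaces; $I$ is the identity operator on $H$. $A: H\to H$ is a constant (time-independent) linear operator which is self-adjoint and positive, $A=A^*>0$ (i.e. $(Au,u)>0$ for $u\neq0$). The linear operators (restriction operators) $G_\alpha: H\to H_\alpha$, with adjoints $G_\alpha^*:H_\alpha\to H$, $\alpha=1,2,\ldots,p$, define a decomposition of the identity operator in $H$: $I=\sum_{\alpha=1}^p G_\alpha^*G_\alpha$. The right-hand side $f:[0,T]\to H$ and the initial value $u^0\in H$ are given. *)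

theory Defs
  imports "HOL-Analysis.Analysis"
begin

text \<open>
  The Hilbert space \<open>H\<close> is a type of class \<^class>\<open>real_inner\<close> that is spanned by a finite set
  (completeness is then automatic). This is used instead of \<^class>\<open>euclidean_space\<close>, which
  excludes dimension 0. The spaces \<open>H\<^sub>\<alpha>\<close>, which may have different dimensions, are finite-dimensional
  linear subspaces \<open>V \<alpha>\<close> of one inner product space. This is no restriction, since every finite family
  of Hilbert spaces embeds isometrically into its orthogonal direct sum.
\<close>

definition fin_dim_subspace :: "'a::real_vector set \<Rightarrow> bool" where
  "fin_dim_subspace S \<longleftrightarrow> (\<exists>B. finite B \<and> S = span B)"

text \<open>
  The library operator \<^const>\<open>adjoint\<close> is a choice operator. On a finite-dimensional domain the adjoint
  exists, whatever the codomain, so the choice is well defined. For \<open>G\<close> with range in a subspace \<open>V\<close>,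
  the adjoint of \<open>G : H \<rightarrow> V\<close> is the restriction of \<open>adjoint G\<close> to \<open>V\<close>.
\<close>

lemma inner_adjoint_fin_dim:
  fixes G :: "'a::real_inner \<Rightarrow> 'b::real_inner"
  assumes fin: "fin_dim_subspace (UNIV :: 'a set)" and G: "linear G"
  shows "G x \<bullet> y = x \<bullet> adjoint G y"
proof -
  obtain B :: "'a set" where B: "finite B" "UNIV = span B"
    using fin unfolding fin_dim_subspace_def by blast
  obtain C where C: "finite C" "span C = span B" "pairwise orthogonal C"
    using basis_orthogonal[OF B(1)] by blast
  define h where "h = (\<lambda>y. \<Sum>c\<in>C. ((G c \<bullet> y) / (c \<bullet> c)) *\<^sub>R c)"
  have on_C: "G c \<bullet> y = c \<bullet> h y" if "c \<in> C" for c y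
  proof -
    have "c \<bullet> h y = (\<Sum>d\<in>C. ((G d \<bullet> y) / (d \<bullet> d)) * (c \<bullet> d))"
      by (simp add: h_def inner_sum_right)
    also have "\<dots> = (\<Sum>d\<in>C. if d = c then G c \<bullet> y else 0)"
    proof (rule sum.cong)
      fix d assume "d \<in> C"
      show "((G d \<bullet> y) / (d \<bullet> d)) * (c \<bullet> d) = (if d = c then G c \<bullet> y else 0)"
      proof (cases "d = c")
        case True
        then show ?thesis by (cases "c = 0") (auto simp: linear_0[OF G])
      next
        case False
        then have "c \<bullet> d = 0"
          using C(3) that \<open>d \<in> C\<close> by (auto simp: pairwise_def orthogonal_def)
        with False show ?thesis by simp
      qed
    qed simp
    also have "\<dots> = G c \<bullet> y" using C(1) that by simp
    finally show ?thesis by simp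
  qed
  have "G x \<bullet> y = x \<bullet> h y" for x y
  proof -
    have "x \<in> span C" using B(2) C(2) by auto
    then show ?thesis
    proof (induction rule: span_induct_alt)
      case base
      show ?case by (simp add: linear_0[OF G])
    next
      case (step a c z)
      then show ?case
        by (simp add: linear_add[OF G] linear_cmul[OF G] inner_add_left on_C)
    qed
  qed
  then have "\<forall>x y. G x \<bullet> y = x \<bullet> h y" by blast
  then show ?thesis using adjoint_unique by metis
qed

text \<open>
  At \<open>t = T\<close> the derivative is the one-sided derivative. Since the equations are only imposed for
  \<open>0 < t \<le> T\<close>, continuity on the closed interval is what ties the solution to its initial value.
\<close>

definition solves_cauchy ::
  "real \<Rightarrow> ('a::real_inner \<Rightarrow> 'a) \<Rightarrow> (real \<Rightarrow> 'a) \<Rightarrow> 'a \<Rightarrow> (real \<Rightarrow> 'a) \<Rightarrow> bool" where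
  "solves_cauchy T A f u0 u \<longleftrightarrow>
     continuous_on {0..T} u \<and>
     (\<forall>t\<in>{0<..T}. \<exists>D. (u has_vector_derivative D) (at t within {0..T}) \<and> D + A (u t) = f t) \<and>
     u 0 = u0"

definition solves_decomposed ::
  "real \<Rightarrow> nat \<Rightarrow> (nat \<Rightarrow> 'b::real_inner set) \<Rightarrow> (nat \<Rightarrow> 'a::real_inner \<Rightarrow> 'b) \<Rightarrow> ('a \<Rightarrow> 'a) \<Rightarrow>
     (real \<Rightarrow> 'a) \<Rightarrow> 'a \<Rightarrow> (nat \<Rightarrow> real \<Rightarrow> 'b) \<Rightarrow> bool" where
  "solves_decomposed T p V G A f u0 v \<longleftrightarrow>
     (\<forall>\<alpha>\<in>{1..p}.
        (\<forall>t\<in>{0..T}. v \<alpha> t \<in> V \<alpha>) \<and>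
        continuous_on {0..T} (v \<alpha>) \<and>
        (\<forall>t\<in>{0<..T}. \<exists>D. (v \<alpha> has_vector_derivative D) (at t within {0..T}) \<and>
           D + (\<Sum>\<beta>=1..p. G \<alpha> (A (adjoint (G \<beta>) (v \<beta> t)))) = G \<alpha> (f t)) \<and>
        v \<alpha> 0 = G \<alpha> u0)"

end

theory Submission
  imports Defs
begin

text \<open>
  Apply \<open>G\<^sub>\<alpha>\<^sup>*\<close> to the \<open>\<alpha>\<close>-th equation and sum over \<open>\<alpha>\<close>. The coupling term equals
  \<open>G\<^sub>\<alpha> (A u)\<close> with \<open>u = \<Sum>\<beta>. G\<^sub>\<beta>\<^sup>* u\<^sub>\<beta>\<close>, for every \<open>\<alpha>\<close>, so the decomposition of the identity
  \<open>\<Sum>\<alpha>. G\<^sub>\<alpha>\<^sup>* G\<^sub>\<alpha> = I\<close> collapses the coupling terms to \<open>A u\<close>, the right-hand sides to \<open>f\<close> and the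
  initial values to \<open>u\<^sup>0\<close>.

  The analytic content is that \<open>G\<^sub>\<alpha>\<^sup>*\<close> commutes with the time derivative, for which it must be
  a bounded operator (\<open>bounded_linear_adjoint_fin_dim\<close>). Its domain is the whole type containing the
  spaces \<open>H\<^sub>\<alpha>\<close>, which may be infinite-dimensional, so boundedness is read off from
  an explicit formula for the adjoint in terms of an orthogonal spanning set of \<open>H\<close>.
\<close>

text \<open>
  Gram-Schmidt gives an orthogonal spanning set \<open>C\<close>. The remainder of the expansion of \<open>x\<close> is
  orthogonal to \<open>C\<close>, hence to the whole space, hence to itself. If \<open>C\<close> contains \<open>0\<close>, the
  corresponding summand is \<open>0\<close>.
\<close>

lemma fin_dim_orthogonal_expansion:
  assumes "fin_dim_subspace (UNIV :: 'a::real_inner set)"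
  obtains C :: "'a::real_inner set" where "finite C"
    and "\<forall>x. x = (\<Sum>c\<in>C. ((c \<bullet> x) / (c \<bullet> c)) *\<^sub>R c)"
proof -
  obtain B :: "'a set" where B: "finite B" "UNIV = span B"
    using assms unfolding fin_dim_subspace_def by blast
  obtain C where C: "finite C" "span C = span B" "pairwise orthogonal C"
    using basis_orthogonal[OF B(1)] by blast
  have "x = (\<Sum>c\<in>C. ((c \<bullet> x) / (c \<bullet> c)) *\<^sub>R c)" for x
  proof -
    let ?r = "x - (\<Sum>c\<in>C. ((c \<bullet> x) / (c \<bullet> c)) *\<^sub>R c)"
    have "orthogonal ?r c" if c: "c \<in> C" for c
    proof -
      have "c \<bullet> d = 0" if "d \<in> C - {c}" for d
        using C(3) c that by (auto simp: pairwise_def orthogonal_def)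
      then have "(\<Sum>d\<in>C - {c}. (d \<bullet> x) / (d \<bullet> d) * (c \<bullet> d)) = 0"
        by (intro sum.neutral) simp
      then have "c \<bullet> ?r = c \<bullet> x - (c \<bullet> x) / (c \<bullet> c) * (c \<bullet> c)"
        using sum.remove[OF C(1) c, of "\<lambda>d. (d \<bullet> x) / (d \<bullet> d) * (c \<bullet> d)"]
        by (simp add: inner_diff_right inner_sum_right)
      also have "\<dots> = 0"
        by (cases "c = 0") auto
      finally show ?thesis
        by (simp add: orthogonal_def inner_commute)
    qed
    moreover have "?r \<in> span C"
      using B(2) C(2) by auto
    ultimately have "orthogonal ?r ?r"
      using orthogonal_to_span by blast
    then show ?thesis
      by (simp add: orthogonal_self)
  qed
  with C(1) show thesis
    using that by blast
qed

text \<open>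
  Expanding \<open>G\<^sup>* y\<close> as above gives the coefficients \<open>(c, G\<^sup>* y) / (c, c) = (G c, y) / (c, c)\<close>,
  which are bounded functionals of \<open>y\<close> by Cauchy-Schwarz.
\<close>

lemma bounded_linear_adjoint_fin_dim:
  fixes G :: "'a::real_inner \<Rightarrow> 'b::real_inner"
  assumes "fin_dim_subspace (UNIV :: 'a set)" and "linear G"
  shows "bounded_linear (adjoint G)"
proof -
  obtain C :: "'a set" where "finite C" and C:
    "\<forall>x. x = (\<Sum>c\<in>C. ((c \<bullet> x) / (c \<bullet> c)) *\<^sub>R c)"
    by (rule fin_dim_orthogonal_expansion[OF assms(1)])
  have "adjoint G = (\<lambda>y. \<Sum>c\<in>C. ((G c \<bullet> y) / (c \<bullet> c)) *\<^sub>R c)"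
  proof
    fix y
    show "adjoint G y = (\<Sum>c\<in>C. ((G c \<bullet> y) / (c \<bullet> c)) *\<^sub>R c)"
      using C[rule_format, of "adjoint G y"] unfolding inner_adjoint_fin_dim[OF assms] .
  qed
  moreover have "bounded_linear (\<lambda>y. \<Sum>c\<in>C. ((G c \<bullet> y) / (c \<bullet> c)) *\<^sub>R c)"
    by (intro bounded_linear_sum bounded_linear_scaleR_const
        bounded_linear_compose[OF bounded_linear_divide bounded_linear_inner_right])
  ultimately show ?thesis
    by simp
qed

theorem theorem4:
  fixes A :: "'a::real_inner \<Rightarrow> 'a"
    and V :: "nat \<Rightarrow> 'b::real_inner set"
    and G :: "nat \<Rightarrow> 'a \<Rightarrow> 'b"
    and f :: "real \<Rightarrow> 'a" and u0 :: 'a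
    and v :: "nat \<Rightarrow> real \<Rightarrow> 'b"
    and T :: real and p :: nat
  assumes "fin_dim_subspace (UNIV :: 'a set)"
    and "\<And>\<alpha>. \<alpha> \<in> {1..p} \<Longrightarrow> fin_dim_subspace (V \<alpha>)"
    and "linear A" and "adjoint A = A" and "\<And>w. w \<noteq> 0 \<Longrightarrow> A w \<bullet> w > 0"
    and "\<And>\<alpha>. \<alpha> \<in> {1..p} \<Longrightarrow> linear (G \<alpha>)"
    and "\<And>\<alpha>. \<alpha> \<in> {1..p} \<Longrightarrow> range (G \<alpha>) \<subseteq> V \<alpha>"
    and "\<And>w. (\<Sum>\<alpha>=1..p. adjoint (G \<alpha>) (G \<alpha> w)) = w"
    and "0 < T"
    and "solves_decomposed T p V G A f u0 v"
  shows "solves_cauchy T A f u0 (\<lambda>t. \<Sum>\<alpha>=1..p. adjoint (G \<alpha>) (v \<alpha> t))"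
proof -
  let ?u = "\<lambda>t. \<Sum>\<alpha>=1..p. adjoint (G \<alpha>) (v \<alpha> t)"
  note identity = assms(8)
  have bl: "bounded_linear (adjoint (G \<alpha>))" if "\<alpha> \<in> {1..p}" for \<alpha>
    using bounded_linear_adjoint_fin_dim assms(1,6) that by blast
  have cont: "continuous_on {0..T} (v \<alpha>)"
    and init: "v \<alpha> 0 = G \<alpha> u0"
    and ode: "\<forall>t\<in>{0<..T}. \<exists>D. (v \<alpha> has_vector_derivative D) (at t within {0..T}) \<and>
           D + (\<Sum>\<beta>=1..p. G \<alpha> (A (adjoint (G \<beta>) (v \<beta> t)))) = G \<alpha> (f t)"
    if "\<alpha> \<in> {1..p}" for \<alpha>
    using assms(10) that unfolding solves_decomposed_def by blast+
  have "continuous_on {0..T} ?u"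
    by (intro continuous_on_sum bounded_linear.continuous_on[OF bl cont])
  moreover have "\<exists>D. (?u has_vector_derivative D) (at t within {0..T}) \<and> D + A (?u t) = f t"
    if t: "t \<in> {0<..T}" for t
  proof -
    have coupling: "(\<Sum>\<beta>=1..p. G \<alpha> (A (adjoint (G \<beta>) (v \<beta> t)))) = G \<alpha> (A (?u t))"
      if "\<alpha> \<in> {1..p}" for \<alpha>
      by (simp only: linear_sum[OF assms(3)] linear_sum[OF assms(6)[OF that]])
    have deriv: "(v \<alpha> has_vector_derivative G \<alpha> (f t - A (?u t))) (at t within {0..T})"
      if \<alpha>: "\<alpha> \<in> {1..p}" for \<alpha>
    proof -
      obtain D where D: "(v \<alpha> has_vector_derivative D) (at t within {0..T})"
        and "D + G \<alpha> (A (?u t)) = G \<alpha> (f t)"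
        using bspec[OF ode[OF \<alpha>] t] unfolding coupling[OF \<alpha>] by blast
      then have "D = G \<alpha> (f t - A (?u t))"
        unfolding linear_diff[OF assms(6)[OF \<alpha>]] by (metis add_diff_cancel_right')
      with D show ?thesis by (simp only:)
    qed
    have "(?u has_vector_derivative (\<Sum>\<alpha>=1..p. adjoint (G \<alpha>) (G \<alpha> (f t - A (?u t)))))
        (at t within {0..T})"
      by (intro has_vector_derivative_sum bounded_linear.has_vector_derivative[OF bl deriv])
    then have "(?u has_vector_derivative (f t - A (?u t))) (at t within {0..T})"
      unfolding identity .
    then show ?thesis
      using diff_add_cancel by blast
  qed
  moreover have "?u 0 = u0"
    using init identity by simp
  ultimately show ?thesis
    unfolding solves_cauchy_def by blast
qed

end
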